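(* Let $\mathcal T\subset\mathbb{R}^n$ be the closure of an open set, let $d(x)$ denote the distance of $x$ from $\mathcal T$, and let $T$ be the minimum time function of the system $\dot x_t=f(x_t,a_t)$ with target $\mathcal T$. Suppose that for $\bar x\in\partial\mathcal T$ there are $r,C>0$, $r\le1$, such that $$T(x)\le C|x-\bar x|^{1/2},\qquad x\in B_r(\bar x).$$ Let $K\ge1$, $q\ge1$ and define $$D:=(B_r(\bar x)\setminus\{\bar x\})\cap\{x:K\,d(x)\le|x-\bar x|^q\},\qquad B:=\partial\mathcal T\cap(B_r(\bar x)\setminus\{\bar x\}).$$ Let $L,R>0$ and $s\in(0,1]$ be constants, and assume that for all $y\in B$ there are $r_y,\rho_y>0$ such that $$T(x)\le\frac{2L}{\rho_y}d(x)\ \text{ for all }x\in B_{r_y}(y),\qquad r_y^s\le R\rho_y,\qquad\text{and}\qquad D\subset\bigcup_{y\in B}B_{r_y}(y).$$ Then for some $M\ge0$ and $\bar s=\min\{1/(2q),1-s\}$, $$T(x)\le M\,d(x)^{\bar s},\qquad x\in B_r(\bar x).$$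
   Context: $B_r(x)$ denotes the closed ball. System: $f:\mathbb{R}^n\times A\to\mathbb{R}^n$ is continuous, $A\subset\mathbb{R}^m$ compact, with uniqueness of trajectories; controls $a_\cdot:[0,+\infty)\to A$ are piecewise continuous. Minimum time function: $T(x)=\inf_{a_\cdot}t_x(a_\cdot)$, $t_x(a_\cdot)=\inf\{t\ge0:x_t\in\mathcal T\}$, where $x_\cdot$ is the trajectory with control $a_\cdot$ and $x_0=x$ ($\inf\emptyset=+\infty$); in particular $T\equiv0$ on $\mathcal T$. *)

theory Defs
  imports "HOL-Analysis.Analysis"
begin

text \<open>Only the values on \<open>[0, \<infinity>)\<close> matter: on every bounded interval there are finitely many
  discontinuities, and all one-sided limits exist in the ambient space.\<close>

definition piecewise_continuous :: "(real \<Rightarrow> 'a::topological_space) \<Rightarrow> bool" where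
  "piecewise_continuous a \<longleftrightarrow>
     (\<forall>\<tau>\<ge>0. \<exists>S. finite S \<and> continuous_on ({0..\<tau>} - S) a) \<and>
     (\<forall>t\<ge>0. \<exists>l. (a \<longlongrightarrow> l) (at_right t)) \<and>
     (\<forall>t>0. \<exists>l. (a \<longlongrightarrow> l) (at_left t))"

definition controls :: "(real^'m) set \<Rightarrow> (real \<Rightarrow> real^'m) set" where
  "controls A = {a. piecewise_continuous a \<and> (\<forall>t\<ge>0. a t \<in> A)}"

text \<open>As controls may jump, the differential equation is required outside a finite set of times;
  continuity of \<open>y\<close> makes this equivalent to the integral equation.\<close>

definition trajectory ::
  "((real^'n) \<times> (real^'m) \<Rightarrow> real^'n) \<Rightarrow> (real \<Rightarrow> real^'m) \<Rightarrow> real^'n \<Rightarrow> real \<Rightarrow> (real \<Rightarrow> real^'n) \<Rightarrow> bool"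
where
  "trajectory f a x \<tau> y \<longleftrightarrow>
     y 0 = x \<and> continuous_on {0..\<tau>} y \<and>
     (\<exists>S. finite S \<and>
        (\<forall>t\<in>{0..\<tau>} - S. (y has_vector_derivative f (y t, a t)) (at t within {0..\<tau>})))"

definition unique_trajectories ::
  "((real^'n) \<times> (real^'m) \<Rightarrow> real^'n) \<Rightarrow> (real^'m) set \<Rightarrow> bool"
where
  "unique_trajectories f A \<longleftrightarrow>
     (\<forall>a\<in>controls A. \<forall>x \<tau> y z. 0 \<le> \<tau> \<longrightarrow> trajectory f a x \<tau> y \<longrightarrow> trajectory f a x \<tau> z \<longrightarrow>
        (\<forall>t\<in>{0..\<tau>}. y t = z t))"

text \<open>Trajectories need not exist for all times. Under uniqueness, a trajectory on \<open>[0, t]\<close> is the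
  restriction of the maximal one, so the set below consists of the times at which the maximal
  trajectory starting at \<open>x\<close> lies in the target. Empty infima are \<open>\<infinity>\<close>.\<close>

definition hitting_time ::
  "((real^'n) \<times> (real^'m) \<Rightarrow> real^'n) \<Rightarrow> (real^'n) set \<Rightarrow> (real \<Rightarrow> real^'m) \<Rightarrow> real^'n \<Rightarrow> ereal"
where
  "hitting_time f \<T> a x = Inf (ereal ` {t. 0 \<le> t \<and> (\<exists>y. trajectory f a x t y \<and> y t \<in> \<T>)})"

definition min_time ::
  "((real^'n) \<times> (real^'m) \<Rightarrow> real^'n) \<Rightarrow> (real^'m) set \<Rightarrow> (real^'n) set \<Rightarrow> real^'n \<Rightarrow> ereal"
where
  "min_time f A \<T> x = (INF a\<in>controls A. hitting_time f \<T> a x)"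

end

theory Submission
  imports Defs
begin

text \<open>
  The region \<open>D\<close> separates two regimes. Outside \<open>D\<close> the distance \<open>d x\<close> is bounded below by a
  multiple of \<open>norm (x - xbar) powr q\<close>, so the square root estimate around \<open>xbar\<close>
  turns into an estimate by \<open>d x powr (1 / (2 * q))\<close> (\<open>powr_bound_from_power_separation\<close>). Inside
  \<open>D\<close> the point \<open>x\<close> lies in a ball \<open>cball y (ry y)\<close> whose center belongs to the target, so
  \<open>d x \<le> ry y\<close>; the slope \<open>2 * L / \<rho> y\<close> of the linear estimate, which may blow up like
  \<open>ry y powr (-s)\<close>, is therefore at most a multiple of \<open>d x powr (-s)\<close>, and this leaves
  \<open>d x powr (1 - s)\<close> (\<open>linear_bound_imp_powr_bound\<close>). Since \<open>d x \<le> r \<le> 1\<close>, both powers are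
  dominated by the one with the smaller exponent.
\<close>

lemma powr_bound_from_power_separation:
  fixes u \<delta> C K p q :: real
  assumes "0 \<le> C" "0 < K" "0 < q" "0 \<le> p" "0 \<le> u" "0 \<le> \<delta>"
    and sep: "u powr q \<le> K * \<delta>"
  shows "C * u powr p \<le> C * K powr (p / q) * \<delta> powr (p / q)"
proof -
  have "u powr p = (u powr q) powr (p / q)"
    using assms by (simp add: powr_powr)
  also have "\<dots> \<le> (K * \<delta>) powr (p / q)"
    using assms by (intro powr_mono2) auto
  also have "\<dots> = K powr (p / q) * \<delta> powr (p / q)"
    using assms by (simp add: powr_mult)
  finally show ?thesis
    using \<open>0 \<le> C\<close> by (simp add: mult_left_mono mult.assoc)
qed

text \<open>
  The condition \<open>\<eta> powr s \<le> R * \<rho>\<close> bounds the slope \<open>1 / \<rho>\<close> by \<open>R * \<eta> powr (-s)\<close>, and on the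
  scale \<open>\<delta> \<le> \<eta>\<close> by \<open>R * \<delta> powr (-s)\<close>; one factor \<open>\<delta>\<close> then yields the power \<open>1 - s\<close>.
\<close>

lemma linear_bound_imp_powr_bound:
  fixes c \<delta> \<eta> \<rho> R s :: real
  assumes "0 \<le> c" "0 < \<rho>" "0 < \<delta>" "\<delta> \<le> \<eta>" "0 \<le> s"
    and slope: "\<eta> powr s \<le> R * \<rho>"
  shows "c / \<rho> * \<delta> \<le> c * R * \<delta> powr (1 - s)"
proof -
  have "\<delta> powr s \<le> R * \<rho>"
    using assms powr_mono2[of s \<delta> \<eta>] by linarith
  then have "\<delta> powr s * \<delta> powr (1 - s) \<le> R * \<rho> * \<delta> powr (1 - s)"
    by (intro mult_right_mono) auto
  then have "\<delta> \<le> R * \<rho> * \<delta> powr (1 - s)"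
    using \<open>0 < \<delta>\<close> by (simp flip: powr_add)
  then have "\<delta> / \<rho> \<le> R * \<delta> powr (1 - s)"
    using \<open>0 < \<rho>\<close> by (simp add: field_simps)
  from mult_left_mono[OF this \<open>0 \<le> c\<close>] show ?thesis
    by (simp add: mult.assoc)
qed

theorem proposition3p6:
  fixes f :: "(real^'n) \<times> (real^'m) \<Rightarrow> real^'n"
    and A :: "(real^'m) set"
    and \<T> D B :: "(real^'n) set"
    and T :: "real^'n \<Rightarrow> ereal"
    and d :: "real^'n \<Rightarrow> real"
    and xbar :: "real^'n"
    and r C K q L R s :: real
    and ry \<rho> :: "real^'n \<Rightarrow> real"
  assumes "continuous_on (UNIV \<times> A) f"
    and "compact A"
    and "unique_trajectories f A"
    and "\<exists>U. open U \<and> \<T> = closure U"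
    and d_def: "d = (\<lambda>x. infdist x \<T>)"
    and T_def: "T = min_time f A \<T>"
    and "xbar \<in> frontier \<T>"
    and "0 < r" and "r \<le> 1" and "0 < C"
    and "\<forall>x\<in>cball xbar r. T x \<le> ereal (C * norm (x - xbar) powr (1/2))"
    and "1 \<le> K" and "1 \<le> q"
    and D_def: "D = (cball xbar r - {xbar}) \<inter> {x. K * d x \<le> norm (x - xbar) powr q}"
    and B_def: "B = frontier \<T> \<inter> (cball xbar r - {xbar})"
    and "0 < L" and "0 < R" and "0 < s" and "s \<le> 1"
    and "\<forall>y\<in>B. 0 < ry y \<and> 0 < \<rho> y"
    and "\<forall>y\<in>B. \<forall>x\<in>cball y (ry y). T x \<le> ereal (2 * L / \<rho> y * d x)"
    and "\<forall>y\<in>B. ry y powr s \<le> R * \<rho> y"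
    and "D \<subseteq> (\<Union>y\<in>B. cball y (ry y))"
  shows "\<exists>M\<ge>0. \<forall>x\<in>cball xbar r. T x \<le> ereal (M * d x powr (min (1 / (2 * q)) (1 - s)))"
proof -
  define \<sigma> where "\<sigma> = min (1 / (2 * q)) (1 - s)"
  define M\<^sub>1 where "M\<^sub>1 = C * K powr (1 / (2 * q))"
  define M\<^sub>2 where "M\<^sub>2 = 2 * L * R"
  define M where "M = max M\<^sub>1 M\<^sub>2"
  note near_xbar = assms(11) and near_B = assms(21) and radius = assms(22) and cover = assms(23)
  have M: "0 \<le> M\<^sub>1" "0 \<le> M\<^sub>2"
    unfolding M\<^sub>1_def M\<^sub>2_def using assms by auto
  have "closed \<T>"
    using assms(4) by auto
  then have frontier_sub: "frontier \<T> \<subseteq> \<T>"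
    by (rule frontier_subset_closed)
  have "T x \<le> ereal (M * d x powr \<sigma>)" if x: "x \<in> cball xbar r" for x
  proof -
    define \<delta> where "\<delta> = d x"
    have "0 \<le> \<delta>"
      by (simp add: \<delta>_def d_def infdist_nonneg)
    have dist_x: "norm (x - xbar) \<le> r"
      using x by (simp add: dist_norm norm_minus_commute)
    have "\<delta> \<le> norm (x - xbar)"
      using frontier_sub \<open>xbar \<in> frontier \<T>\<close> infdist_le[of xbar \<T> x]
      by (auto simp: \<delta>_def d_def dist_norm)
    then have "\<delta> \<le> 1"
      using dist_x \<open>r \<le> 1\<close> by linarith
    have weaken: "T x \<le> ereal (M * \<delta> powr \<sigma>)"
      if "T x \<le> ereal (N * \<delta> powr \<alpha>)" "0 \<le> N" "N \<le> M" "\<sigma> \<le> \<alpha>" for N \<alpha>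
    proof -
      have "N * \<delta> powr \<alpha> \<le> M * \<delta> powr \<sigma>"
        using that \<open>0 \<le> \<delta>\<close> \<open>\<delta> \<le> 1\<close> by (intro mult_mono powr_mono') auto
      with that(1) show ?thesis
        by (meson ereal_less_eq(3) order_trans)
    qed
    have "T x \<le> ereal (M * \<delta> powr \<sigma>)"
    proof (cases "x \<in> D")
      case True
      then obtain y where y: "y \<in> B" "x \<in> cball y (ry y)"
        using cover by blast
      then have T_le: "T x \<le> ereal (2 * L / \<rho> y * \<delta>)"
        using near_B by (auto simp: \<delta>_def)
      have "y \<in> \<T>"
        using y frontier_sub by (auto simp: B_def)
      then have "\<delta> \<le> ry y"
        using y infdist_le[of y \<T> x] by (simp add: \<delta>_def d_def dist_commute)
      \<comment> \<open>For points of the target both sides vanish, also when the exponent is \<open>0\<close>, because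
        \<open>0 powr 0 = 0\<close>.\<close>
      have "2 * L / \<rho> y * \<delta> \<le> M\<^sub>2 * \<delta> powr (1 - s)"
      proof (cases "\<delta> = 0")
        case False
        then show ?thesis
          unfolding M\<^sub>2_def
          using \<open>0 \<le> \<delta>\<close> \<open>\<delta> \<le> ry y\<close> radius y assms
          by (intro linear_bound_imp_powr_bound[where \<eta> = "ry y"]) auto
      qed simp
      then have "T x \<le> ereal (M\<^sub>2 * \<delta> powr (1 - s))"
        using T_le by (meson ereal_less_eq(3) order_trans)
      then show ?thesis
        using M weaken[of M\<^sub>2 "1 - s"] by (auto simp: M_def \<sigma>_def)
    next
      case False
      \<comment> \<open>The point \<open>xbar\<close>, which \<open>D\<close> omits, satisfies this inequality trivially.\<close>
      then have "norm (x - xbar) powr q \<le> K * \<delta>"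
        using x \<open>0 \<le> \<delta>\<close> \<open>1 \<le> K\<close> by (cases "x = xbar") (auto simp: D_def \<delta>_def)
      then have "C * norm (x - xbar) powr (1/2) \<le> C * K powr (1/2 / q) * \<delta> powr (1/2 / q)"
        using assms \<open>0 \<le> \<delta>\<close> by (intro powr_bound_from_power_separation) auto
      then have "C * norm (x - xbar) powr (1/2) \<le> M\<^sub>1 * \<delta> powr (1 / (2 * q))"
        by (simp add: M\<^sub>1_def)
      moreover have "T x \<le> ereal (C * norm (x - xbar) powr (1/2))"
        using near_xbar x by blast
      ultimately have "T x \<le> ereal (M\<^sub>1 * \<delta> powr (1 / (2 * q)))"
        by (meson ereal_less_eq(3) order_trans)
      then show ?thesis
        using M weaken[of M\<^sub>1 "1 / (2 * q)"] by (auto simp: M_def \<sigma>_def)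
    qed
    then show ?thesis
      by (simp add: \<delta>_def)
  qed
  moreover have "0 \<le> M"
    using M by (simp add: M_def)
  ultimately show ?thesis
    unfolding \<sigma>_def by blast
qed

end
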